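(* Let $u:\mathbb{R}^n\to\mathbb{R}$ be a $C^{2}$ solution of $$\sum_{i=1}^{n}\arctan\lambda_{i}=-u+\frac{1}{2}\sum_{i=1}^{n}x_{i}\frac{\partial u}{\partial x_{i}}\quad\text{on }\mathbb{R}^n,$$ where $\lambda_{i}=\lambda_i(x)$ $(i=1,2,\dots,n)$ are the eigenvalues of the Hessian $D^{2}u(x)$. Suppose that $$-1\leq\lambda_{i}(x)\leq 1\quad\text{for all } i \text{ and all }x\in\mathbb{R}^n.$$ Then $u$ must be a quadratic polynomial.
   Context: "Quadratic polynomial" means a polynomial of degree at most two (i.e. $D^2u$ is a constant matrix). *)

theory Defs
  imports "HOL-Analysis.Analysis" "HOL-Computational_Algebra.Polynomial"
begin

definition partial :: "'n \<Rightarrow> (real ^ 'n \<Rightarrow> real) \<Rightarrow> real ^ 'n \<Rightarrow> real" where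
  "partial i f x = deriv (\<lambda>t. f (x + t *\<^sub>R axis i 1)) 0"

(* Since deriv is total, differentiability has to be required explicitly. Frechet
   differentiability of f and of its first partials is no extra demand: it follows from the
   continuity of all partials up to order two. *)
definition C2 :: "(real ^ 'n \<Rightarrow> real) \<Rightarrow> bool" where
  "C2 f \<longleftrightarrow>
     (\<forall>x. f differentiable (at x)) \<and>
     (\<forall>i x. partial i f differentiable (at x)) \<and>
     (\<forall>i j. continuous_on UNIV (partial i (partial j f)))"

definition hessian :: "(real ^ 'n \<Rightarrow> real) \<Rightarrow> real ^ 'n \<Rightarrow> real ^ 'n ^ 'n" where
  "hessian f x = (\<chi> i j. partial i (partial j f) x)"

definition charpoly :: "'a::comm_ring_1 ^ 'n ^ 'n \<Rightarrow> 'a poly" where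
  "charpoly A = det (mat [:0, 1:] - map_matrix (\<lambda>a. [:a:]) A)"

(* The family l lists the eigenvalues of A with their algebraic multiplicities, in any order. *)
definition eigenvalue_family :: "real ^ 'n ^ 'n \<Rightarrow> ('n \<Rightarrow> real) \<Rightarrow> bool" where
  "eigenvalue_family A l \<longleftrightarrow> charpoly A = (\<Prod>i\<in>UNIV. [:- l i, 1:])"

definition quadratic_polynomial :: "(real ^ 'n \<Rightarrow> real) \<Rightarrow> bool" where
  "quadratic_polynomial f \<longleftrightarrow>
     (\<exists>(a :: 'n \<Rightarrow> 'n \<Rightarrow> real) (b :: 'n \<Rightarrow> real) (c :: real).
        \<forall>x. f x = (\<Sum>i\<in>UNIV. \<Sum>j\<in>UNIV. a i j * x $ i * x $ j) + (\<Sum>i\<in>UNIV. b i * x $ i) + c)"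

end

theory Submission
  imports Defs
begin

text \<open>
  Write \<open>\<Theta>\<close> for the phase, the sum of the arctangents of the eigenvalues of the Hessian. If \<open>\<Theta>\<close> is
  constant, the equation says that \<open>u + \<Theta>\<close> satisfies Euler's identity for functions homogeneous of
  degree two, and such a function that is \<open>C\<^sup>2\<close> at the origin equals its second-order Taylor
  polynomial. So everything rests on a Liouville theorem for the bounded function \<open>\<Theta>\<close>.

  For smooth \<open>u\<close>, differentiating the equation twice shows that \<open>\<Theta>\<close> solves the linear drift equation
  \<open>a\<^sub>i\<^sub>j \<partial>\<^sub>i\<partial>\<^sub>j\<Theta> - x \<bullet> \<nabla>\<Theta> / 2 = 0\<close> with \<open>a = (1 + (D\<^sup>2u)\<^sup>2)\<^sup>-\<^sup>1\<close>. As \<open>u\<close> is only \<open>C\<^sup>2\<close>, the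
  equation is not differentiated. It is compared instead with its own dilation: the function
  \<open>W x = u (r x) / r\<^sup>2 - u x\<close> is \<open>C\<^sup>2\<close> and, by Cauchy's mean value theorem, equals
  \<open>(1 - 1 / r\<^sup>2) * \<Theta> (\<rho> x)\<close> for some \<open>\<rho>\<close> between \<open>1\<close> and \<open>r\<close> (lemma
  \<open>rescaling_difference\<close>). Where \<open>W\<close> is touched from above by a smooth function, the
  Hessians of \<open>u\<close> at \<open>r x\<close> and at \<open>x\<close> are ordered up to the Hessian of the test function, and monotonicity
  of eigenvalues turns this into a comparison of the values of \<open>\<Theta>\<close> there (lemmas
  \<open>sum_arctan_eigenvalues_le\<close> and \<open>touching_estimate\<close>). Letting \<open>r\<close> tend to \<open>1\<close> gives the maximum
  principle for \<open>\<Theta>\<close> (lemma \<open>phase_comparison\<close>).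

  The drift term makes the equation recurrent: for every \<open>y\<close> and every radius there is a function that
  is a strict supersolution outside the ball around \<open>y\<close> and tends to infinity (lemma
  \<open>barrier_parameters\<close>). A small multiple of it forces \<open>\<Theta>\<close> everywhere below the supremum
  of \<open>\<Theta>\<close> over the ball. Shrinking the ball yields \<open>\<Theta> x \<le> \<Theta> y\<close> for all \<open>x\<close> and \<open>y\<close>
  (lemma \<open>phase_le\<close>), so that \<open>\<Theta>\<close> is constant.
\<close>

section \<open>Orthonormal eigenbases of symmetric matrices\<close>

lemma rayleigh_maximizer_is_eigenvector:
  fixes f :: "'a::euclidean_space \<Rightarrow> 'a"
  assumes f: "linear f" and sym: "\<And>x y. f x \<bullet> y = x \<bullet> f y"
    and S: "subspace S" and inv: "\<And>x. x \<in> S \<Longrightarrow> f x \<in> S" and nz: "S \<noteq> {0}"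
  obtains x d where "x \<in> S" "norm x = 1" "f x = d *\<^sub>R x"
proof -
  let ?K = "S \<inter> sphere 0 1"
  have "compact ?K"
    using S by (simp add: closed_Int_compact closed_subspace)
  obtain s where s: "s \<in> S" "s \<noteq> 0"
    using nz S subspace_0 by fastforce
  have "(1 / norm s) *\<^sub>R s \<in> ?K"
    using s S by (simp add: subspace_scale)
  then have "?K \<noteq> {}" by blast
  have "continuous_on ?K (\<lambda>y. y \<bullet> f y)"
    by (intro continuous_intros linear_continuous_on) (simp add: f linear_conv_bounded_linear[symmetric])
  from continuous_attains_sup[OF \<open>compact ?K\<close> \<open>?K \<noteq> {}\<close> this]
  obtain x where x: "x \<in> S" "norm x = 1" and mx: "\<And>y. y \<in> S \<Longrightarrow> norm y = 1 \<Longrightarrow> y \<bullet> f y \<le> x \<bullet> f x"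
    by auto
  define d where "d = x \<bullet> f x"
  have le: "y \<bullet> f y \<le> d * (y \<bullet> y)" if "y \<in> S" for y
  proof (cases "y = 0")
    case True then show ?thesis by simp
  next
    case False
    have "((1 / norm y) *\<^sub>R y) \<bullet> f ((1 / norm y) *\<^sub>R y) \<le> d"
      unfolding d_def using that S False by (intro mx) (auto simp: subspace_scale)
    then show ?thesis
      using False by (simp add: linear_scale[OF f] dot_square_norm field_simps power2_eq_square)
  qed
  define g where "g = f x - d *\<^sub>R x"
  have gS: "g \<in> S"
    unfolding g_def using x S inv by (auto intro: subspace_diff subspace_scale)
  have xx: "x \<bullet> x = 1" using x by (simp add: dot_square_norm)
  have gx: "g \<bullet> x = 0"
    unfolding g_def inner_diff_left d_def by (simp add: xx inner_commute)
  \<comment> \<open>Moving from \<open>x\<close> in the direction \<open>g\<close> raises the quotient to first order by \<open>2 * (g \<bullet> g)\<close>.\<close>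
  have key: "2 * t * (g \<bullet> g) + t^2 * (g \<bullet> f g - d * (g \<bullet> g)) \<le> 0" for t
  proof -
    have "(x + t *\<^sub>R g) \<bullet> f (x + t *\<^sub>R g) \<le> d * ((x + t *\<^sub>R g) \<bullet> (x + t *\<^sub>R g))"
      using x gS S by (intro le) (auto intro: subspace_add subspace_scale)
    moreover have "g \<bullet> f x = g \<bullet> g"
      using gx by (simp add: g_def inner_diff_right inner_commute)
    moreover have "x \<bullet> f g = g \<bullet> g"
      using sym[of x g] calculation(2) by (simp add: inner_commute)
    ultimately show ?thesis
      using gx xx
      by (simp add: linear_add[OF f] linear_scale[OF f] inner_add_left inner_add_right d_def
          inner_commute algebra_simps power2_eq_square)
  qed
  have "g \<bullet> g \<le> 0"
  proof (rule ccontr)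
    assume "\<not> g \<bullet> g \<le> 0"
    then have p: "g \<bullet> g > 0" by linarith
    let ?c = "g \<bullet> f g - d * (g \<bullet> g)"
    \<comment> \<open>A step so short that the second-order term cannot cancel the first-order gain.\<close>
    define t where "t = (g \<bullet> g) / (\<bar>?c\<bar> + 1)"
    have t: "t > 0" using p by (simp add: t_def)
    have "t * (2 * (g \<bullet> g) + t * ?c) \<le> 0" using key[of t] by (simp add: algebra_simps power2_eq_square)
    then have "2 * (g \<bullet> g) + t * ?c \<le> 0" using t by (simp add: mult_le_0_iff)
    moreover have "t * \<bar>?c\<bar> \<le> g \<bullet> g"
      using p by (simp add: t_def field_simps)
    moreover have "- (t * \<bar>?c\<bar>) \<le> t * ?c"
      using t by (metis abs_ge_minus_self abs_mult abs_of_pos minus_le_iff)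
    ultimately show False using p by linarith
  qed
  then have "g = 0" using inner_gt_zero_iff[of g] by (metis not_le)
  then show thesis using that[of x d] x by (simp add: g_def)
qed

text \<open>
  The orthogonal complement of an eigenvector inside an invariant subspace is again invariant, because
  the operator is symmetric. So eigenvectors can be split off one at a time.
\<close>

lemma symmetric_operator_eigenbasis:
  fixes f :: "'a::euclidean_space \<Rightarrow> 'a"
  assumes f: "linear f" and sym: "\<And>x y. f x \<bullet> y = x \<bullet> f y"
    and "subspace S" and "\<And>x. x \<in> S \<Longrightarrow> f x \<in> S"
  shows "\<exists>B \<subseteq> S. pairwise orthogonal B \<and> (\<forall>b\<in>B. norm b = 1 \<and> (\<exists>d. f b = d *\<^sub>R b)) \<and> span B = S"
  using assms(3,4)
proof (induction "dim S" arbitrary: S rule: less_induct)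
  case less
  show ?case
  proof (cases "S = {0}")
    case True
    then show ?thesis by (intro exI[of _ "{}"]) auto
  next
    case False
    from rayleigh_maximizer_is_eigenvector[OF f sym less.prems False]
    obtain x d where x: "x \<in> S" "norm x = 1" "f x = d *\<^sub>R x" by blast
    have xx: "x \<bullet> x = 1" using x by (simp add: dot_square_norm)
    let ?T = "S \<inter> {y. orthogonal x y}"
    have subT: "subspace ?T"
      using less.prems(1) by (intro subspace_inter subspace_orthogonal_to_vector)
    have invT: "f y \<in> ?T" if "y \<in> ?T" for y
      using that less.prems(2) sym[of x y] x(3) by (auto simp: orthogonal_def)
    have "x \<notin> ?T" using xx by (simp add: orthogonal_def)
    then have "?T \<subset> S" using x(1) by blast
    then have "dim ?T < dim S"
      using subT less.prems(1) by (intro dim_psubset) (metis span_eq_iff)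
    from less.hyps[OF this subT invT]
    obtain B where B: "B \<subseteq> ?T" "pairwise orthogonal B" "\<forall>b\<in>B. norm b = 1 \<and> (\<exists>d. f b = d *\<^sub>R b)"
        "span B = ?T" by blast
    have "y \<in> span (insert x B)" if "y \<in> S" for y
    proof -
      have "y - (y \<bullet> x) *\<^sub>R x \<in> ?T"
        using that x less.prems(1) xx
        by (auto simp: orthogonal_def inner_diff_right inner_commute intro: subspace_diff subspace_scale)
      then show ?thesis using B(4) unfolding span_insert by blast
    qed
    moreover have "span (insert x B) \<subseteq> S"
      using x B less.prems(1) by (intro span_minimal) auto
    moreover have "pairwise orthogonal (insert x B)"
      using B(1,2) by (auto simp: pairwise_insert orthogonal_commute)
    ultimately show ?thesis
      using x B by (intro exI[of _ "insert x B"]) auto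
  qed
qed

lemma symmetric_matrix_orthonormal_eigenbasis:
  fixes A :: "real^'n^'n"
  assumes sym: "transpose A = A"
  obtains e :: "'n \<Rightarrow> real^'n" and d where
    "\<And>i j. e i \<bullet> e j = (if i = j then 1 else 0)" "\<And>i. A *v e i = d i *\<^sub>R e i"
proof -
  have "(A *v x) \<bullet> y = x \<bullet> (A *v y)" for x y
    by (metis dot_lmul_matrix sym transpose_matrix_vector)
  from symmetric_operator_eigenbasis[OF _ this, of UNIV]
  obtain B where B: "pairwise orthogonal B" "\<forall>b\<in>B. norm b = 1 \<and> (\<exists>d. A *v b = d *\<^sub>R b)"
    "span B = (UNIV :: (real^'n) set)" by auto
  have ind: "independent B"
    using B by (intro pairwise_orthogonal_independent) auto
  then have "card B = CARD('n)"
    using B(3) by (metis dim_span dim_eq_card_independent dim_UNIV DIM_cart DIM_real mult_1_right)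
  then obtain e :: "'n \<Rightarrow> real^'n" where e: "bij_betw e UNIV B"
    by (metis ind finite_class.finite_UNIV finite_same_card_bij finiteI_independent)
  have eB: "e i \<in> B" for i using e by (auto simp: bij_betw_def)
  have "\<forall>i. \<exists>c. A *v e i = c *\<^sub>R e i"
    using B(2) eB by blast
  then obtain d where "\<And>i. A *v e i = d i *\<^sub>R e i"
    by metis
  moreover have "e i \<bullet> e j = (if i = j then 1 else 0)" for i j
  proof (cases "i = j")
    case True
    then show ?thesis using B(2) eB by (simp add: norm_eq_1)
  next
    case False
    then have "e i \<noteq> e j"
      using e by (auto simp: bij_betw_def inj_def)
    then show ?thesis
      using B(1) eB False unfolding pairwise_def orthogonal_def by simp
  qed
  ultimately show thesis using that by blast
qed

lemma poly_charpoly: "poly (charpoly A) t = det (mat t - A)"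
  for A :: "real^'n^'n"
proof -
  have "poly ((mat [:0, 1:] - map_matrix (\<lambda>a. [:a:]) A) $ i $ j) t = (mat t - A) $ i $ j" for i j
    by (simp add: mat_def map_matrix_def)
  then show ?thesis
    unfolding charpoly_def det_def by (simp only: poly_sum poly_prod poly_mult of_int_poly) simp
qed

lemma det_trace_orthogonally_diagonalized:
  fixes A :: "real^'n^'n"
    and e :: "'n \<Rightarrow> real^'n"
  assumes e: "\<And>i j. e i \<bullet> e j = (if i = j then 1 else 0)" "\<And>i. A *v e i = d i *\<^sub>R e i"
  shows "det A = (\<Prod>i\<in>UNIV. d i)" "trace A = (\<Sum>i\<in>UNIV. d i)"
proof -
  define Q :: "real^'n^'n" where "Q = (\<chi> i j. e j $ i)"
  define D :: "real^'n^'n" where "D = (\<chi> i j. if i = j then d j else 0)"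
  have "transpose Q ** Q = mat 1"
    using e(1) by (simp add: vec_eq_iff Q_def transpose_def matrix_matrix_mult_def mat_def inner_vec_def)
  then have Q: "Q ** transpose Q = mat 1" by (simp add: matrix_left_right_inverse)
  have "A ** Q = Q ** D"
  proof -
    have "(A ** Q) $ i $ j = (Q ** D) $ i $ j" for i j
    proof -
      have "(A ** Q) $ i $ j = (A *v e j) $ i"
        by (simp add: matrix_matrix_mult_def matrix_vector_mult_def Q_def)
      also have "\<dots> = (Q ** D) $ i $ j"
        by (simp add: e(2) matrix_matrix_mult_def Q_def D_def if_distrib cong: if_cong)
      finally show ?thesis .
    qed
    then show ?thesis by (simp add: vec_eq_iff)
  qed
  then have A: "A = (Q ** D) ** transpose Q"
    by (metis Q matrix_mul_assoc matrix_mul_rid)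
  have "det A = det (Q ** transpose Q) * det D"
    unfolding A det_mul by simp
  also have "det D = (\<Prod>i\<in>UNIV. d i)"
    by (subst det_diagonal) (auto simp: D_def)
  finally show "det A = (\<Prod>i\<in>UNIV. d i)" by (simp add: Q)
  have "trace A = trace (transpose Q ** Q ** D)"
    unfolding A by (subst trace_mul_sym) (simp add: matrix_mul_assoc)
  then show "trace A = (\<Sum>i\<in>UNIV. d i)"
    using \<open>transpose Q ** Q = mat 1\<close> by (simp add: trace_def D_def)
qed

lemma linear_factors_unique:
  fixes l d :: "'n::finite \<Rightarrow> real"
  assumes "(\<Prod>i\<in>UNIV. [:- l i, 1:]) = (\<Prod>i\<in>UNIV. [:- d i, 1:])"
  shows "image_mset l (mset_set UNIV) = image_mset d (mset_set UNIV)"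
proof -
  have "proots (\<Prod>i\<in>UNIV. [:- f i, 1:]) = image_mset f (mset_set UNIV)" for f :: "'n \<Rightarrow> real"
  proof -
    have "(\<Sum>i\<in>I. {#f i#}) = image_mset f (mset_set I)" if "finite I" for I :: "'n set"
      using that by induction auto
    then show ?thesis by (subst proots_prod) auto
  qed
  then show ?thesis using assms by metis
qed


text \<open>
  The eigenvalues are given only as the roots of the characteristic polynomial. Unique factorization
  matches them, with multiplicity, to the eigenvalues of an orthonormal eigenbasis, so that the basis
  can be reindexed to fit the given order.
\<close>

lemma eigenvalue_family_eigenbasis:
  fixes A :: "real^'n^'n"
  assumes sym: "transpose A = A" and l: "eigenvalue_family A l"
  obtains e :: "'n \<Rightarrow> real^'n" where
    "\<And>i j. e i \<bullet> e j = (if i = j then 1 else 0)" "\<And>i. A *v e i = l i *\<^sub>R e i"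
proof -
  from symmetric_matrix_orthonormal_eigenbasis[OF sym]
  obtain e :: "'n \<Rightarrow> real^'n" and d where
    e: "\<And>i j. e i \<bullet> e j = (if i = j then 1 else 0)" "\<And>i. A *v e i = d i *\<^sub>R e i" by blast
  have "poly (charpoly A) t = poly (\<Prod>i\<in>UNIV. [:- d i, 1:]) t" for t
  proof -
    have "(mat t - A) *v e i = (t - d i) *\<^sub>R e i" for i
    proof -
      have "mat t *v e i = t *\<^sub>R e i"
        by (simp add: vec_eq_iff matrix_vector_mult_def mat_def if_distrib[of "\<lambda>c. c * _"] cong: if_cong)
      then show ?thesis
        by (simp add: matrix_vector_mult_diff_rdistrib e(2) scaleR_diff_left)
    qed
    from det_trace_orthogonally_diagonalized(1)[OF e(1) this] show ?thesis
      by (simp add: poly_charpoly poly_prod)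
  qed
  then have "(\<Prod>i\<in>UNIV. [:- l i, 1:]) = (\<Prod>i\<in>UNIV. [:- d i, 1:])"
    using l by (metis eigenvalue_family_def poly_eq_poly_eq_iff ext)
  then have "image_mset l (mset_set UNIV) = image_mset d (mset_set UNIV)"
    by (rule linear_factors_unique)
  from image_mset_eq_implies_permutes[OF finite_class.finite_UNIV this]
  obtain p where p: "p permutes UNIV" "\<And>i. l i = d (p i)" by auto
  show thesis
  proof (rule that[of "e \<circ> p"])
    show "(e \<circ> p) i \<bullet> (e \<circ> p) j = (if i = j then 1 else 0)" for i j
      using e(1) permutes_inj[OF p(1)] by (auto simp: inj_def)
    show "A *v (e \<circ> p) i = l i *\<^sub>R (e \<circ> p) i" for i
      using e(2) p(2) by simp
  qed
qed

section \<open>Monotonicity of eigenvalues and of the sum of their arctangents\<close>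

lemma span_of_eigenvectors:
  fixes A :: "real^'n^'n" and e :: "'n \<Rightarrow> real^'n"
  assumes e: "\<And>i j. e i \<bullet> e j = (if i = j then 1 else 0)" "\<And>i. A *v e i = a i *\<^sub>R e i"
    and v: "v \<in> span (e ` I)"
  obtains x where "v \<bullet> v = (\<Sum>i\<in>I. (x i)\<^sup>2)" "v \<bullet> (A *v v) = (\<Sum>i\<in>I. a i * (x i)\<^sup>2)"
proof -
  have inj: "inj_on e I"
    using e(1) by (intro inj_onI) (metis zero_neq_one)
  from v obtain u where "v = (\<Sum>w\<in>e ` I. u w *\<^sub>R w)"
    by (auto simp: span_finite)
  then have veq: "v = (\<Sum>i\<in>I. u (e i) *\<^sub>R e i)"
    by (simp add: sum.reindex[OF inj])
  then have Av: "A *v v = (\<Sum>i\<in>I. (u (e i) * a i) *\<^sub>R e i)"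
    by (simp add: linear_sum[OF matrix_vector_mul_linear] matrix_vector_mult_scaleR e(2))
  have "v \<bullet> w = (\<Sum>i\<in>I. u (e i) * y i)" if "w = (\<Sum>i\<in>I. y i *\<^sub>R e i)" for w y
    unfolding veq that
    by (simp add: inner_sum_left inner_sum_right e(1) if_distrib mult.commute cong: if_cong)
  from this[OF veq] this[OF Av] show thesis
    by (intro that[of "\<lambda>i. u (e i)"]) (simp_all add: power2_eq_square mult_ac)
qed

text \<open>
  Weyl's monotonicity principle in counting form. On the span of the eigenvectors of \<open>A\<close> with eigenvalue above
  \<open>t\<close> the form of \<open>A\<close> exceeds \<open>t\<close> times the squared norm; on the span of those of \<open>B\<close> with
  shifted eigenvalue at most \<open>t\<close> the shifted form of \<open>B\<close> does not. The two spaces therefore meet only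
  in \<open>0\<close>, which bounds the sum of their dimensions.
\<close>

lemma eigenvalue_counting_mono:
  fixes A B :: "real^'n^'n" and e f :: "'n \<Rightarrow> real^'n"
  assumes e: "\<And>i j. e i \<bullet> e j = (if i = j then 1 else 0)" "\<And>i. A *v e i = a i *\<^sub>R e i"
    and f: "\<And>i j. f i \<bullet> f j = (if i = j then 1 else 0)" "\<And>i. B *v f i = b i *\<^sub>R f i"
    and le: "\<And>v. v \<bullet> (A *v v) \<le> v \<bullet> (B *v v) + c * (v \<bullet> v)"
  shows "card {i. a i > t} \<le> card {i. b i + c > t}"
proof -
  let ?I = "{i. a i > t}" and ?J = "{i. b i + c \<le> t}"
  have dim: "dim (span (g ` I)) = card I"
    if g: "\<And>i j. g i \<bullet> g j = (if i = j then 1 else 0)" for g :: "'n \<Rightarrow> real^'n" and I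
  proof -
    have "inj_on g I"
      using g by (intro inj_onI) (metis zero_neq_one)
    moreover have "independent (g ` I)"
      using g by (intro pairwise_orthogonal_independent)
        (auto simp: pairwise_def orthogonal_def, metis inner_zero_left zero_neq_one)
    ultimately show ?thesis
      by (simp add: dim_eq_card_independent card_image)
  qed
  have "v = 0" if v: "v \<in> span (e ` ?I)" "v \<in> span (f ` ?J)" for v
  proof -
    obtain x where x: "v \<bullet> v = (\<Sum>i\<in>?I. (x i)\<^sup>2)" "v \<bullet> (A *v v) = (\<Sum>i\<in>?I. a i * (x i)\<^sup>2)"
      using span_of_eigenvectors[OF e v(1)] by blast
    obtain y where y: "v \<bullet> v = (\<Sum>i\<in>?J. (y i)\<^sup>2)" "v \<bullet> (B *v v) = (\<Sum>i\<in>?J. b i * (y i)\<^sup>2)"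
      using span_of_eigenvectors[OF f v(2)] by blast
    have "v \<bullet> (B *v v) + c * (v \<bullet> v) = (\<Sum>i\<in>?J. (b i + c) * (y i)\<^sup>2)"
      by (simp add: y sum_distrib_left sum.distrib algebra_simps)
    also have "\<dots> \<le> (\<Sum>i\<in>?J. t * (y i)\<^sup>2)"
      by (intro sum_mono mult_right_mono) auto
    also have "\<dots> = t * (v \<bullet> v)" by (simp add: y sum_distrib_left)
    finally have "v \<bullet> (A *v v) \<le> t * (v \<bullet> v)" using le[of v] by linarith
    then have "(\<Sum>i\<in>?I. (a i - t) * (x i)\<^sup>2) \<le> 0"
      by (simp add: x sum_distrib_left sum_subtractf algebra_simps)
    moreover have nonneg: "0 \<le> (a i - t) * (x i)\<^sup>2" if "i \<in> ?I" for i
      using that by simp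
    ultimately have "(\<Sum>i\<in>?I. (a i - t) * (x i)\<^sup>2) = 0"
      by (metis (mono_tags, lifting) antisym sum_nonneg)
    then have "\<forall>i\<in>?I. (a i - t) * (x i)\<^sup>2 = 0"
      by (subst (asm) sum_nonneg_eq_0_iff) (use nonneg in auto)
    then have "\<forall>i\<in>?I. x i = 0" by auto
    then have "v \<bullet> v = 0" using x(1) by simp
    then show ?thesis by simp
  qed
  then have "dim (span (e ` ?I) \<inter> span (f ` ?J)) = 0"
    by (subst dim_eq_0) auto
  moreover have "dim {x + y |x y. x \<in> span (e ` ?I) \<and> y \<in> span (f ` ?J)} \<le> CARD('n)"
    using dim_subset_UNIV[of "{x + y |x y. x \<in> span (e ` ?I) \<and> y \<in> span (f ` ?J)}"] by simp
  ultimately have "card ?I + card ?J \<le> CARD('n)"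
    using dim_sums_Int[OF subspace_span[of "e ` ?I"] subspace_span[of "f ` ?J"]] 
    unfolding dim[OF e(1)] dim[OF f(1)] by linarith
  moreover have "card ?J = CARD('n) - card {i. b i + c > t}"
  proof -
    have "?J = UNIV - {i. b i + c > t}" by auto
    then show ?thesis by (simp add: card_Diff_subset)
  qed
  moreover have "card {i. b i + c > t} \<le> CARD('n)" by (rule card_mono) auto
  ultimately show ?thesis by linarith
qed

text \<open>
  If every superlevel set of \<open>f\<close> is at most as large as that of \<open>g\<close>, the values of \<open>f\<close> in decreasing order
  lie below those of \<open>g\<close>. The induction removes the two largest values, which avoids sorting.
\<close>

lemma sum_mono_of_counting:
  fixes f g :: "'a \<Rightarrow> real" and h :: "real \<Rightarrow> real"
  assumes "finite I" "finite J" "card I = card J"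
    and "\<And>t. card {i\<in>I. f i > t} \<le> card {j\<in>J. g j > t}"
    and "\<And>x y. x \<in> S \<Longrightarrow> y \<in> S \<Longrightarrow> x \<le> y \<Longrightarrow> h x \<le> h y"
    and "f ` I \<subseteq> S" "g ` J \<subseteq> S"
  shows "(\<Sum>i\<in>I. h (f i)) \<le> (\<Sum>j\<in>J. h (g j))"
  using assms
proof (induction "card I" arbitrary: I J)
  case 0
  then show ?case by simp
next
  case (Suc n)
  then have ne: "I \<noteq> {}" "J \<noteq> {}" by auto
  obtain i where i: "i \<in> I" "\<And>k. k \<in> I \<Longrightarrow> f k \<le> f i"
    using ne Suc.prems(1) obtains_MAX[of I f] by (metis Max_ge finite_imageI imageI)
  obtain j where j: "j \<in> J" "\<And>k. k \<in> J \<Longrightarrow> g k \<le> g j"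
    using ne Suc.prems(2) obtains_MAX[of J g] by (metis Max_ge finite_imageI imageI)
  have le: "f i \<le> g j"
  proof (rule ccontr)
    assume "\<not> f i \<le> g j"
    then have "i \<in> {k\<in>I. f k > g j}" using i by auto
    then have "card {k\<in>I. f k > g j} > 0" using Suc.prems(1) by (auto simp: card_gt_0_iff)
    moreover have "{k\<in>J. g k > g j} = {}" using j(2) by force
    ultimately show False using Suc.prems(4)[of "g j"] by (metis card.empty not_le)
  qed
  have "card {k\<in>I - {i}. f k > t} \<le> card {k\<in>J - {j}. g k > t}" for t
  proof (cases "f i > t")
    case True
    have "{k\<in>I - {i}. f k > t} = {k\<in>I. f k > t} - {i}" "{k\<in>J - {j}. g k > t} = {k\<in>J. g k > t} - {j}"
      by auto
    moreover have "i \<in> {k\<in>I. f k > t}" "j \<in> {k\<in>J. g k > t}" using True i j le by auto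
    ultimately show ?thesis using Suc.prems(4)[of t] by simp
  next
    case False
    then have "{k\<in>I - {i}. f k > t} = {}" using i(2) by force
    then show ?thesis by (metis card.empty zero_le)
  qed
  then have "(\<Sum>k\<in>I - {i}. h (f k)) \<le> (\<Sum>k\<in>J - {j}. h (g k))"
    using Suc.prems Suc.hyps(2) i(1) j(1)
    by (intro Suc.hyps(1)) (auto simp: image_subset_iff)
  moreover have "h (f i) \<le> h (g j)"
    using Suc.prems(6,7) i(1) j(1) le by (intro Suc.prems(5)) auto
  ultimately show ?case
    using Suc.prems(1,2) i(1) j(1) by (simp add: sum.remove)
qed

text \<open>
  On \<open>[-2, 2]\<close> the derivative \<open>1 / (1 + x\<^sup>2)\<close> of the arctangent is at least \<open>1 / 5\<close>. With the
  Hessian bounded, this makes the equation uniformly elliptic.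
\<close>

lemma arctan_minus_fifth_mono:
  fixes x y :: real
  assumes "-2 \<le> x" "x \<le> y" "y \<le> 2"
  shows "arctan x - x / 5 \<le> arctan y - y / 5"
proof (rule DERIV_nonneg_imp_nondecreasing[of x y "\<lambda>x. arctan x - x / 5"])
  fix z assume z: "x \<le> z" "z \<le> y"
  then have "\<bar>z\<bar> \<le> 2" using assms by auto
  then have "z\<^sup>2 \<le> 4" using abs_le_square_iff[of z 2] by simp
  then have "inverse (1 + z\<^sup>2) - 1 / 5 \<ge> 0"
    by (simp add: field_simps add_pos_nonneg)
  then show "\<exists>d. ((\<lambda>x. arctan x - x / 5) has_real_derivative d) (at z) \<and> d \<ge> 0"
    by (intro exI conjI, auto intro!: derivative_eq_intros)
qed fact

lemma arctan_add_le: "0 \<le> c \<Longrightarrow> arctan (x + c) \<le> arctan x + c" for x c :: real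
proof -
  assume c: "0 \<le> c"
  have "(x + c) - arctan (x + c) \<ge> x - arctan x"
  proof (rule DERIV_nonneg_imp_nondecreasing[of x "x + c" "\<lambda>x. x - arctan x"])
    fix z :: real
    have "1 - inverse (1 + z\<^sup>2) \<ge> 0" by (simp add: field_simps add_pos_nonneg)
    then show "\<exists>d. ((\<lambda>x. x - arctan x) has_real_derivative d) (at z) \<and> d \<ge> 0"
      by (intro exI conjI, auto intro!: derivative_eq_intros)
  qed (use c in simp)
  then show ?thesis by simp
qed

text \<open>
  This plays the role of the linearized equation, with ellipticity constants \<open>1 / 5\<close> and \<open>1\<close>: adding
  \<open>c\<close> times the identity raises the sum of the arctangents by at most \<open>CARD('n) * c\<close>, while taking
  away the rank-one form \<open>s * (z \<bullet> v)\<^sup>2\<close> lowers it by at least a fifth of the trace of that form. Eigenvalue monotonicity is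
  applied to the increasing function \<open>arctan x - x / 5\<close>; the sum of its linear part is a trace, where
  the rank-one term is visible. The condition \<open>c \<le> 1\<close> keeps the shifted eigenvalues in \<open>[-2, 2]\<close>.
\<close>

lemma sum_arctan_eigenvalues_le:
  fixes A B :: "real^'n^'n" and c s :: real
  assumes symA: "transpose A = A" and symB: "transpose B = B"
    and a: "eigenvalue_family A a" and b: "eigenvalue_family B b"
    and bda: "\<And>i. \<bar>a i\<bar> \<le> 1" and bdb: "\<And>i. \<bar>b i\<bar> \<le> 1"
    and c: "0 \<le> c" "c \<le> 1" and s: "0 \<le> s"
    and le: "\<And>v. v \<bullet> (A *v v) \<le> v \<bullet> (B *v v) + c * (v \<bullet> v) - s * (z \<bullet> v)\<^sup>2"
  shows "(\<Sum>i\<in>UNIV. arctan (a i)) \<le> (\<Sum>i\<in>UNIV. arctan (b i)) + CARD('n) * c - s / 5 * (z \<bullet> z)"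
proof -
  obtain e :: "'n \<Rightarrow> real^'n" where
    e: "\<And>i j. e i \<bullet> e j = (if i = j then 1 else 0)" "\<And>i. A *v e i = a i *\<^sub>R e i"
    using eigenvalue_family_eigenbasis[OF symA a] by blast
  obtain f :: "'n \<Rightarrow> real^'n" where
    f: "\<And>i j. f i \<bullet> f j = (if i = j then 1 else 0)" "\<And>i. B *v f i = b i *\<^sub>R f i"
    using eigenvalue_family_eigenbasis[OF symB b] by blast
  have "v \<bullet> (A *v v) \<le> v \<bullet> (B *v v) + c * (v \<bullet> v)" for v
    using le[of v] s by (smt (verit) mult_nonneg_nonneg zero_le_power2)
  from eigenvalue_counting_mono[OF e f this]
  have "card {i\<in>UNIV. a i > t} \<le> card {i\<in>UNIV. b i + c > t}" for t by simp
  then have "(\<Sum>i\<in>UNIV. arctan (a i) - a i / 5) \<le> (\<Sum>i\<in>UNIV. arctan (b i + c) - (b i + c) / 5)"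
  proof (intro sum_mono_of_counting[where S = "{-2..2}" and h = "\<lambda>x. arctan x - x / 5"])
    have "a i \<in> {-2..2}" for i using bda[of i] by auto
    then show "range a \<subseteq> {-2..2}" by blast
    have "b i + c \<in> {-2..2}" for i using bdb[of i] c by auto
    then show "range (\<lambda>i. b i + c) \<subseteq> {-2..2}" by blast
  qed (auto intro: arctan_minus_fifth_mono)
  also have "\<dots> \<le> (\<Sum>i\<in>UNIV. arctan (b i) + c - (b i + c) / 5)"
    using arctan_add_le[OF c(1)] by (intro sum_mono) simp
  finally have 1: "(\<Sum>i\<in>UNIV. arctan (a i)) \<le>
      (\<Sum>i\<in>UNIV. arctan (b i)) + CARD('n) * c - (trace B + CARD('n) * c - trace A) / 5"
    unfolding det_trace_orthogonally_diagonalized(2)[OF e] det_trace_orthogonally_diagonalized(2)[OF f]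
    by (simp add: sum.distrib sum_subtractf sum_divide_distrib[symmetric] diff_divide_distrib add_divide_distrib,
        simp add: algebra_simps)
  \<comment> \<open>The rank-one term is seen by the trace: sum the form inequality over the standard basis.\<close>
  have tr: "(\<Sum>i\<in>UNIV. axis i 1 \<bullet> (M *v axis i 1)) = trace M" for M :: "real^'n^'n"
    by (simp add: trace_def inner_axis' matrix_vector_mult_basis column_def)
  have "(\<Sum>i\<in>UNIV. axis i 1 \<bullet> (A *v axis i 1)) \<le>
      (\<Sum>i\<in>UNIV. axis i 1 \<bullet> (B *v axis i 1) + c * (axis i 1 \<bullet> (axis i 1 :: real^'n)) - s * (z \<bullet> axis i 1)\<^sup>2)"
    by (intro sum_mono le)
  also have "\<dots> = trace B + CARD('n) * c - s * (z \<bullet> z)"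
    by (simp add: sum.distrib sum_subtractf tr sum_distrib_left[symmetric] inner_axis inner_vec_def[of z z]
        power2_eq_square)
  finally have "trace A \<le> trace B + CARD('n) * c - s * (z \<bullet> z)" by (simp add: tr)
  with 1 show ?thesis by (simp add: field_simps)
qed

section \<open>Directional derivatives and symmetry of the Hessian\<close>

definition gradient :: "(real^'n \<Rightarrow> real) \<Rightarrow> real^'n \<Rightarrow> real^'n" where
  "gradient f x = (\<chi> i. partial i f x)"

lemma has_derivative_gradient:
  fixes f :: "real^'n \<Rightarrow> real"
  assumes "f differentiable (at x)"
  shows "(f has_derivative (\<lambda>h. h \<bullet> gradient f x)) (at x)"
proof -
  obtain f' where f': "(f has_derivative f') (at x)"
    using assms by (auto simp: differentiable_def)
  interpret f': bounded_linear f' using f' by (rule has_derivative_bounded_linear)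
  have partial: "partial i f x = f' (axis i 1)" for i
  proof -
    have "((\<lambda>t. x + t *\<^sub>R axis i 1) has_derivative (\<lambda>t. t *\<^sub>R axis i 1)) (at (0::real))"
      by (auto intro!: derivative_eq_intros)
    then have "((\<lambda>t. f (x + t *\<^sub>R axis i 1)) has_derivative (\<lambda>t. f' (t *\<^sub>R axis i 1))) (at 0)"
      by (rule has_derivative_compose) (use f' in simp)
    then have "((\<lambda>t. f (x + t *\<^sub>R axis i 1)) has_real_derivative f' (axis i 1)) (at 0)"
      by (simp add: has_field_derivative_def f'.scaleR mult_commute_abs)
    then show ?thesis by (simp add: partial_def DERIV_imp_deriv)
  qed
  have "f' h = h \<bullet> gradient f x" for h
  proof -
    have "f' h = f' (\<Sum>i\<in>UNIV. h $ i *\<^sub>R axis i 1)"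
      using basis_expansion[of h] by (simp add: scalar_mult_eq_scaleR)
    also have "\<dots> = h \<bullet> gradient f x"
      by (simp add: f'.sum f'.scaleR inner_vec_def gradient_def partial)
    finally show ?thesis .
  qed
  then have "f' = (\<lambda>h. h \<bullet> gradient f x)" by blast
  then show ?thesis using f' by simp
qed

lemma line_derivative:
  fixes f :: "real^'n \<Rightarrow> real"
  assumes "f differentiable (at (x + t *\<^sub>R v))"
  shows "((\<lambda>s. f (x + s *\<^sub>R v)) has_real_derivative v \<bullet> gradient f (x + t *\<^sub>R v)) (at t)"
proof -
  have "((\<lambda>s. x + s *\<^sub>R v) has_derivative (\<lambda>s. s *\<^sub>R v)) (at t)"
    by (auto intro!: derivative_eq_intros)
  from has_derivative_compose[OF this has_derivative_gradient[OF assms]]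
  show ?thesis by (simp add: has_field_derivative_def mult_commute_abs)
qed

lemma C2_line_derivatives:
  fixes u :: "real^'n \<Rightarrow> real"
  assumes "C2 u"
  shows "((\<lambda>s. u (x + s *\<^sub>R v)) has_real_derivative v \<bullet> gradient u (x + t *\<^sub>R v)) (at t)"
    and "((\<lambda>s. v \<bullet> gradient u (x + s *\<^sub>R v)) has_real_derivative
           v \<bullet> (hessian u (x + t *\<^sub>R v) *v v)) (at t)"
proof -
  show "((\<lambda>s. u (x + s *\<^sub>R v)) has_real_derivative v \<bullet> gradient u (x + t *\<^sub>R v)) (at t)"
    using assms by (intro line_derivative) (simp add: C2_def)
  let ?p = "x + t *\<^sub>R v"
  have "((\<lambda>s. \<Sum>i\<in>UNIV. v $ i * partial i u (x + s *\<^sub>R v)) has_real_derivative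
      (\<Sum>i\<in>UNIV. v $ i * (v \<bullet> gradient (partial i u) ?p))) (at t)"
    using assms by (intro DERIV_sum DERIV_cmult line_derivative) (simp add: C2_def)
  moreover have "(\<Sum>i\<in>UNIV. v $ i * (v \<bullet> gradient (partial i u) ?p)) = v \<bullet> (hessian u ?p *v v)"
  proof -
    have "(\<Sum>i\<in>UNIV. v $ i * (v \<bullet> gradient (partial i u) ?p)) =
        (\<Sum>i\<in>UNIV. \<Sum>j\<in>UNIV. v $ i * (v $ j * partial j (partial i u) ?p))"
      by (simp add: inner_vec_def gradient_def sum_distrib_left)
    also have "\<dots> = (\<Sum>j\<in>UNIV. \<Sum>i\<in>UNIV. v $ i * (v $ j * partial j (partial i u) ?p))"
      by (rule sum.swap)
    also have "\<dots> = v \<bullet> (hessian u ?p *v v)"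
      by (simp add: inner_vec_def matrix_vector_mult_def hessian_def sum_distrib_left mult_ac)
    finally show ?thesis .
  qed
  ultimately show "((\<lambda>s. v \<bullet> gradient u (x + s *\<^sub>R v)) has_real_derivative
      v \<bullet> (hessian u ?p *v v)) (at t)"
    by (simp add: inner_vec_def gradient_def)
qed

lemma line_derivative_axis:
  assumes "f differentiable (at (x + t *\<^sub>R axis i 1))"
  shows "((\<lambda>s. f (x + s *\<^sub>R axis i 1)) has_real_derivative partial i f (x + t *\<^sub>R axis i 1)) (at t)"
  using line_derivative[OF assms] by (simp add: gradient_def inner_axis')

text \<open>
  Two applications of the mean value theorem. The left-hand side of the equation is symmetric in \<open>i\<close> and
  \<open>j\<close>, and this is what makes the mixed partial derivatives agree in the limit.
\<close>

lemma second_difference: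
  fixes u :: "real^'n \<Rightarrow> real"
  assumes "C2 u" and "h > 0"
  obtains s t where "0 < s" "s < h" "0 < t" "t < h"
    "u (x + h *\<^sub>R axis i 1 + h *\<^sub>R axis j 1) - u (x + h *\<^sub>R axis i 1) - u (x + h *\<^sub>R axis j 1) + u x
      = h\<^sup>2 * partial j (partial i u) (x + s *\<^sub>R axis i 1 + t *\<^sub>R axis j 1)"
proof -
  let ?i = "axis i 1 :: real^'n" and ?j = "axis j 1 :: real^'n"
  have du: "u differentiable (at y)" "partial k u differentiable (at y)" for y k
    using assms(1) by (auto simp: C2_def)
  define g where "g s = u ((x + h *\<^sub>R ?j) + s *\<^sub>R ?i) - u (x + s *\<^sub>R ?i)" for s
  have "(g has_real_derivative partial i u ((x + h *\<^sub>R ?j) + s *\<^sub>R ?i) - partial i u (x + s *\<^sub>R ?i)) (at s)" for s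
    unfolding g_def by (intro DERIV_diff line_derivative_axis du)
  from MVT2[of 0 h g, OF assms(2) this]
  obtain s where s: "0 < s" "s < h"
    "g h - g 0 = h * (partial i u ((x + h *\<^sub>R ?j) + s *\<^sub>R ?i) - partial i u (x + s *\<^sub>R ?i))" by auto
  have "((\<lambda>t. partial i u ((x + s *\<^sub>R ?i) + t *\<^sub>R ?j)) has_real_derivative
      partial j (partial i u) ((x + s *\<^sub>R ?i) + t *\<^sub>R ?j)) (at t)" for t
    by (intro line_derivative_axis du)
  from MVT2[of 0 h "\<lambda>t. partial i u ((x + s *\<^sub>R ?i) + t *\<^sub>R ?j)", OF assms(2) this]
  obtain t where t: "0 < t" "t < h" "partial i u ((x + s *\<^sub>R ?i) + h *\<^sub>R ?j) - partial i u (x + s *\<^sub>R ?i)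
      = h * partial j (partial i u) ((x + s *\<^sub>R ?i) + t *\<^sub>R ?j)" by auto
  have "g h - g 0 = h * (h * partial j (partial i u) ((x + s *\<^sub>R ?i) + t *\<^sub>R ?j))"
    using s(3) t(3) by (simp add: add_ac)
  then show thesis
    using that[OF s(1,2) t(1,2)] by (simp add: g_def power2_eq_square algebra_simps)
qed

lemma hessian_symmetric:
  fixes u :: "real^'n \<Rightarrow> real"
  assumes "C2 u"
  shows "transpose (hessian u x) = hessian u x"
proof -
  have "\<bar>partial j (partial i u) x - partial i (partial j u) x\<bar> \<le> e" if "e > 0" for i j e
  proof -
    have cont: "isCont (partial k (partial l u)) x" for k l
      using assms by (auto simp: C2_def continuous_on_eq_continuous_at)
    have e2: "e / 2 > 0" using that by simp
    obtain d1 where d1: "d1 > 0"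
      "\<And>y. dist y x < d1 \<Longrightarrow> dist (partial j (partial i u) y) (partial j (partial i u) x) < e / 2"
      using cont[of j i] e2 unfolding continuous_at_eps_delta by blast
    obtain d2 where d2: "d2 > 0"
      "\<And>y. dist y x < d2 \<Longrightarrow> dist (partial i (partial j u) y) (partial i (partial j u) x) < e / 2"
      using cont[of i j] e2 unfolding continuous_at_eps_delta by blast
    define h where "h = min d1 d2 / 2"
    have h: "h > 0" using d1(1) d2(1) by (simp add: h_def)
    have near: "dist (x + s *\<^sub>R axis k 1 + t *\<^sub>R axis l 1) x < min d1 d2"
      if "0 < s" "s < h" "0 < t" "t < h" for s t k l
    proof -
      have "norm (s *\<^sub>R axis k (1::real) + t *\<^sub>R axis l 1 :: real^'n) \<le> s + t"
        using that by (intro norm_triangle_le) (simp add: norm_axis_1)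
      also have "\<dots> < min d1 d2" using that by (simp add: h_def)
      finally show ?thesis by (simp add: dist_norm add.assoc)
    qed
    obtain s t where st: "0 < s" "s < h" "0 < t" "t < h"
      "u (x + h *\<^sub>R axis i 1 + h *\<^sub>R axis j 1) - u (x + h *\<^sub>R axis i 1) - u (x + h *\<^sub>R axis j 1) + u x
        = h\<^sup>2 * partial j (partial i u) (x + s *\<^sub>R axis i 1 + t *\<^sub>R axis j 1)"
      using second_difference[OF assms h] by blast
    obtain s' t' where st': "0 < s'" "s' < h" "0 < t'" "t' < h"
      "u (x + h *\<^sub>R axis j 1 + h *\<^sub>R axis i 1) - u (x + h *\<^sub>R axis j 1) - u (x + h *\<^sub>R axis i 1) + u x
        = h\<^sup>2 * partial i (partial j u) (x + s' *\<^sub>R axis j 1 + t' *\<^sub>R axis i 1)"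
      using second_difference[OF assms h] by blast
    have "h\<^sup>2 * partial j (partial i u) (x + s *\<^sub>R axis i 1 + t *\<^sub>R axis j 1) =
        h\<^sup>2 * partial i (partial j u) (x + s' *\<^sub>R axis j 1 + t' *\<^sub>R axis i 1)"
    proof -
      have sw: "x + h *\<^sub>R axis j 1 + h *\<^sub>R axis i 1 = x + h *\<^sub>R axis i 1 + h *\<^sub>R axis j 1"
        by (simp add: add_ac)
      show ?thesis using st(5) st'(5)[unfolded sw] by linarith
    qed
    then have "partial j (partial i u) (x + s *\<^sub>R axis i 1 + t *\<^sub>R axis j 1) =
        partial i (partial j u) (x + s' *\<^sub>R axis j 1 + t' *\<^sub>R axis i 1)"
      using h by simp
    moreover have "dist (partial j (partial i u) (x + s *\<^sub>R axis i 1 + t *\<^sub>R axis j 1)) (partial j (partial i u) x) < e / 2"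
      using near[OF st(1-4), of i j] by (intro d1(2)) simp
    moreover have "dist (partial i (partial j u) (x + s' *\<^sub>R axis j 1 + t' *\<^sub>R axis i 1)) (partial i (partial j u) x) < e / 2"
      using near[OF st'(1-4), of j i] by (intro d2(2)) simp
    ultimately have "dist (partial j (partial i u) x) (partial i (partial j u) x) < e"
      by (metis dist_triangle_half_r)
    then show ?thesis by (simp add: dist_real_def)
  qed
  then have "partial j (partial i u) x = partial i (partial j u) x" for i j
    using dense_ge[of 0 "\<bar>partial j (partial i u) x - partial i (partial j u) x\<bar>"] by simp
  then show ?thesis by (simp add: transpose_def hessian_def vec_eq_iff)
qed

lemma local_max_second_derivative:
  fixes p :: "real \<Rightarrow> real"
  assumes p: "\<And>t. (p has_real_derivative p' t) (at t)" and p': "(p' has_real_derivative d) (at 0)"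
    and "e > 0" and mx: "\<And>t. \<bar>t\<bar> < e \<Longrightarrow> p t \<le> p 0"
  shows "p' 0 = 0" "d \<le> 0"
proof -
  show z: "p' 0 = 0"
    using DERIV_local_max[OF p[of 0] assms(3)] mx by simp
  show "d \<le> 0"
  proof (rule ccontr)
    assume "\<not> d \<le> 0"
    then have "0 < d" by simp
    from has_real_derivative_pos_inc_right[OF p' this]
    obtain r where r: "r > 0" "\<And>h. 0 < h \<Longrightarrow> h < r \<Longrightarrow> p' h > 0" using z by auto
    define h where "h = min r e / 2"
    have h: "0 < h" "h < r" "h < e" using r(1) assms(3) by (auto simp: h_def)
    obtain s where s: "0 < s" "s < h" "p h - p 0 = h * p' s"
      using MVT2[of 0 h p p', OF h(1) p] by auto
    have "p h > p 0" using s r(2)[of s] h by (simp add: zero_less_mult_iff algebra_simps)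
    then show False using mx[of h] h by simp
  qed
qed

section \<open>The phase of a self-shrinking solution\<close>

locale hessian_bounded_self_shrinker =
  fixes u :: "real^'n \<Rightarrow> real" and lam :: "real^'n \<Rightarrow> 'n \<Rightarrow> real"
  assumes C2: "C2 u"
    and eigenvalues: "\<And>x. eigenvalue_family (hessian u x) (lam x)"
    and equation: "\<And>x. (\<Sum>i\<in>UNIV. arctan (lam x i)) = - u x + 1 / 2 * (\<Sum>i\<in>UNIV. x $ i * partial i u x)"
    and bound: "\<And>x i. - 1 \<le> lam x i \<and> lam x i \<le> 1"
begin

definition phase :: "real^'n \<Rightarrow> real" where
  "phase x = (\<Sum>i\<in>UNIV. arctan (lam x i))"

lemma phase_eq: "phase x = - u x + (x \<bullet> gradient u x) / 2"
  by (simp add: phase_def equation inner_vec_def gradient_def)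

lemma continuous_on_u: "continuous_on S u"
  using C2 by (auto simp: C2_def intro!: continuous_at_imp_continuous_on differentiable_imp_continuous_within)

lemma continuous_on_phase: "continuous_on S phase"
proof -
  have "continuous_on S (partial i u)" for i
    using C2 by (auto simp: C2_def intro!: continuous_at_imp_continuous_on differentiable_imp_continuous_within)
  then show ?thesis
    unfolding phase_eq[abs_def] inner_vec_def gradient_def
    by (auto intro!: continuous_intros continuous_on_u)
qed

lemma abs_phase_le: "\<bar>phase x\<bar> \<le> 2 * CARD('n)"
proof -
  have "\<bar>arctan t\<bar> \<le> 2" for t
    using arctan_bounded[of t] pi_less_4 by auto
  then have "\<bar>phase x\<bar> \<le> (\<Sum>i\<in>(UNIV :: 'n set). 2)"
    unfolding phase_def by (intro order_trans[OF sum_abs] sum_mono)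
  then show ?thesis by simp
qed

text \<open>
  The equation says that \<open>m \<mapsto> u (m x) / m\<^sup>2\<close> has derivative \<open>2 / m\<^sup>3\<close> times the phase at
  \<open>m x\<close>, and \<open>- 1 / m\<^sup>2\<close> has derivative \<open>2 / m\<^sup>3\<close>; Cauchy's mean value theorem applies to this
  pair. So the dilation quotient approximates the phase by functions of class \<open>C\<^sup>2\<close>.
\<close>

lemma rescaling_difference:
  assumes "1 < r"
  obtains \<rho> where "1 < \<rho>" "\<rho> < r" "u (r *\<^sub>R x) / r\<^sup>2 - u x = (1 - 1 / r\<^sup>2) * phase (\<rho> *\<^sub>R x)"
proof -
  have pos: "m > 0" if "1 \<le> m" for m :: real using that by simp
  have dG: "((\<lambda>m. u (m *\<^sub>R x) / m\<^sup>2) has_real_derivative 2 / m ^ 3 * phase (m *\<^sub>R x)) (at m)" if "1 \<le> m" for m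
  proof -
    have "((\<lambda>m. u (m *\<^sub>R x)) has_real_derivative x \<bullet> gradient u (m *\<^sub>R x)) (at m)"
      using C2_line_derivatives(1)[OF C2, of 0 x m] by simp
    then have "((\<lambda>m. u (m *\<^sub>R x) / m\<^sup>2) has_real_derivative
        ((x \<bullet> gradient u (m *\<^sub>R x)) * m\<^sup>2 - u (m *\<^sub>R x) * (2 * m)) / (m\<^sup>2 * m\<^sup>2)) (at m)"
      using pos[OF that] by (auto intro!: derivative_eq_intros)
    moreover have "((x \<bullet> gradient u (m *\<^sub>R x)) * m\<^sup>2 - u (m *\<^sub>R x) * (2 * m)) / (m\<^sup>2 * m\<^sup>2) =
        2 / m ^ 3 * phase (m *\<^sub>R x)"
      using pos[OF that] by (simp add: phase_eq field_simps power2_eq_square power3_eq_cube)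
    ultimately show ?thesis by simp
  qed
  have dH: "((\<lambda>m. - 1 / m\<^sup>2) has_real_derivative 2 / m ^ 3) (at m)" if "1 \<le> m" for m :: real
    using pos[OF that]
    by (auto intro!: derivative_eq_intros simp: field_simps power2_eq_square power3_eq_cube)
  have "\<exists>c>1. c < r \<and> (u (r *\<^sub>R x) / r\<^sup>2 - u (1 *\<^sub>R x) / 1\<^sup>2) * (2 / c ^ 3) =
      (- 1 / r\<^sup>2 - (- 1 / 1\<^sup>2)) * (2 / c ^ 3 * phase (c *\<^sub>R x))"
    using assms dG dH
    by (intro GMVT'[of 1 r "\<lambda>m. u (m *\<^sub>R x) / m\<^sup>2" "\<lambda>m. - 1 / m\<^sup>2" "\<lambda>m. 2 / m ^ 3"
          "\<lambda>m. 2 / m ^ 3 * phase (m *\<^sub>R x)"]) (auto intro: DERIV_isCont)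
  then obtain c where c: "1 < c" "c < r" "(u (r *\<^sub>R x) / r\<^sup>2 - u x) * (2 / c ^ 3) =
      ((1 - 1 / r\<^sup>2) * phase (c *\<^sub>R x)) * (2 / c ^ 3)"
    by (auto simp: mult_ac)
  moreover have "2 / c ^ 3 \<noteq> 0" using c(1) by simp
  ultimately show thesis using that[of c] mult_right_cancel by blast
qed

text \<open>
  The maximum principle at one scale. At a local maximum of the dilation quotient minus the radial
  test function, the second-order condition bounds the Hessian of \<open>u\<close> at \<open>r x\<close> by that at \<open>x\<close> plus \<open>k\<close> times the
  Hessian \<open>2 * G1 * I + 4 * G2 * (x - y)(x - y)\<^sup>T\<close> of the test function, and hence bounds the phase at \<open>r x\<close>. The
  first-order condition computes the difference of the phases at \<open>r x\<close> and \<open>x\<close> exactly, since the phase involves only \<open>u\<close> and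
  its gradient; no derivative of the phase is needed. For \<open>r\<close> near \<open>1\<close> the right-hand side of the conclusion is
  small, so the test function cannot be a strict supersolution at \<open>x\<close>.
\<close>

lemma touching_estimate:
  fixes G G1 G2 :: "real \<Rightarrow> real" and x y :: "real^'n"
  defines "q \<equiv> \<lambda>z. (z - y) \<bullet> (z - y)"
  assumes r: "1 < r" and k: "k = 1 - 1 / r\<^sup>2"
    and G: "\<And>t. (G has_real_derivative G1 t) (at t)" "\<And>t. (G1 has_real_derivative G2 t) (at t)"
    and sgn: "0 \<le> G1 (q x)" "G2 (q x) \<le> 0" and small: "2 * k * G1 (q x) \<le> 1"
    and e: "0 < e"
    and mx: "\<And>z. dist z x < e \<Longrightarrow> u (r *\<^sub>R z) / r\<^sup>2 - u z - k * G (q z) \<le> u (r *\<^sub>R x) / r\<^sup>2 - u x - k * G (q x)"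
    and \<rho>: "u (r *\<^sub>R x) / r\<^sup>2 - u x = k * phase (\<rho> *\<^sub>R x)"
  shows "G1 (q x) * (x \<bullet> (x - y) - 2 * CARD('n)) - 4 / 5 * G2 (q x) * q x \<le> phase (\<rho> *\<^sub>R x) - phase (r *\<^sub>R x)"
proof -
  have kpos: "0 < k" using r by (simp add: k)
  define z where "z = x - y"
  have qz: "q x = z \<bullet> z" by (simp add: q_def z_def)
  have test: "x \<bullet> gradient u (r *\<^sub>R x) / r - x \<bullet> gradient u x = 2 * k * G1 (q x) * (x \<bullet> z)
     \<and> v \<bullet> (hessian u (r *\<^sub>R x) *v v) \<le> v \<bullet> (hessian u x *v v) + 2 * k * G1 (q x) * (v \<bullet> v) - (- 4 * k * G2 (q x)) * (z \<bullet> v)\<^sup>2"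
    for v
  proof -
    \<comment> \<open>The one-dimensional first and second derivative tests along the line through \<open>x\<close> in direction \<open>v\<close>.\<close>
    have lines: "(v \<bullet> gradient u (r *\<^sub>R x)) / r - v \<bullet> gradient u x - k * (G1 (q x) * (2 * (z \<bullet> v))) = 0
      \<and> v \<bullet> (hessian u (r *\<^sub>R x) *v v) - v \<bullet> (hessian u x *v v)
          - k * (G2 (q x) * (2 * (z \<bullet> v)) * (2 * (z \<bullet> v)) + G1 (q x) * (2 * (v \<bullet> v))) \<le> 0" for v
    proof -
      define Q where "Q t = q (x + t *\<^sub>R v)" for t
      define Q' where "Q' t = 2 * (z \<bullet> v) + 2 * t * (v \<bullet> v)" for t
      have Qeq: "Q t = z \<bullet> z + 2 * t * (z \<bullet> v) + t\<^sup>2 * (v \<bullet> v)" for t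
        by (simp add: Q_def q_def z_def inner_add_left inner_add_right inner_diff_left inner_diff_right
            inner_commute algebra_simps power2_eq_square)
      have dQ: "(Q has_real_derivative Q' t) (at t)" for t
        unfolding Qeq[abs_def] Q'_def by (auto intro!: derivative_eq_intros)
      have dQ': "(Q' has_real_derivative 2 * (v \<bullet> v)) (at t)" for t
        unfolding Q'_def by (auto intro!: derivative_eq_intros)
      have Q0: "Q 0 = q x" "Q' 0 = 2 * (z \<bullet> v)" by (simp_all add: Q_def Q'_def)
      define p where "p t = u (r *\<^sub>R x + t *\<^sub>R (r *\<^sub>R v)) / r\<^sup>2 - u (x + t *\<^sub>R v) - k * G (Q t)" for t
      define p' where "p' t = ((r *\<^sub>R v) \<bullet> gradient u (r *\<^sub>R x + t *\<^sub>R (r *\<^sub>R v))) / r\<^sup>2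
          - v \<bullet> gradient u (x + t *\<^sub>R v) - k * (G1 (Q t) * Q' t)" for t
      define d where "d = ((r *\<^sub>R v) \<bullet> (hessian u (r *\<^sub>R x + 0 *\<^sub>R (r *\<^sub>R v)) *v (r *\<^sub>R v))) / r\<^sup>2
          - v \<bullet> (hessian u (x + 0 *\<^sub>R v) *v v)
          - k * (G2 (Q 0) * Q' 0 * Q' 0 + G1 (Q 0) * (2 * (v \<bullet> v)))"
      have dp: "(p has_real_derivative p' t) (at t)" for t
        unfolding p_def p'_def
        by (intro DERIV_diff DERIV_cdivide DERIV_cmult C2_line_derivatives[OF C2] DERIV_chain2[OF G(1) dQ])
      have dp': "(p' has_real_derivative d) (at 0)"
        unfolding p'_def d_def
        by (intro DERIV_diff DERIV_cdivide DERIV_cmult C2_line_derivatives[OF C2] DERIV_cong[OF DERIV_mult[OF DERIV_chain2[OF G(2) dQ] dQ']])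
           (simp add: algebra_simps)
      define e' where "e' = e / (norm v + 1)"
      have nv: "norm v + 1 > 0" by (simp add: add_nonneg_pos)
      have e': "e' > 0" using e nv by (simp add: e'_def)
      have "p t \<le> p 0" if "\<bar>t\<bar> < e'" for t
      proof -
        have "dist (x + t *\<^sub>R v) x = \<bar>t\<bar> * norm v" by (simp add: dist_norm)
        also have "\<dots> \<le> \<bar>t\<bar> * (norm v + 1)" by (intro mult_left_mono) auto
        also have "\<dots> < e" using that nv by (simp add: e'_def field_simps)
        finally have "dist (x + t *\<^sub>R v) x < e" .
        from mx[OF this] show ?thesis
          by (simp add: p_def Q_def scaleR_add_right mult.commute)
      qed
      from local_max_second_derivative[OF dp dp' e' this]
      have "p' 0 = 0" "d \<le> 0" by auto
      moreover have "p' 0 = (v \<bullet> gradient u (r *\<^sub>R x)) / r - v \<bullet> gradient u x - k * (G1 (q x) * (2 * (z \<bullet> v)))"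
        using r by (simp add: p'_def Q0 power2_eq_square)
      moreover have "d = v \<bullet> (hessian u (r *\<^sub>R x) *v v) - v \<bullet> (hessian u x *v v)
          - k * (G2 (q x) * (2 * (z \<bullet> v)) * (2 * (z \<bullet> v)) + G1 (q x) * (2 * (v \<bullet> v)))"
        using r by (simp add: d_def Q0 power2_eq_square matrix_vector_mult_scaleR)
      ultimately show ?thesis by simp
    qed
    show ?thesis
      using lines[of x] lines[of v] by (simp add: inner_commute algebra_simps power2_eq_square)
  qed
  have "\<bar>lam w i\<bar> \<le> 1" for w i using bound[of w i] by (simp add: abs_le_iff)
  then have "phase (r *\<^sub>R x) \<le> phase x + CARD('n) * (2 * k * G1 (q x)) - (- 4 * k * G2 (q x)) / 5 * (z \<bullet> z)"
    unfolding phase_def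
    using test sgn kpos small
    by (intro sum_arctan_eigenvalues_le[OF hessian_symmetric[OF C2] hessian_symmetric[OF C2] eigenvalues eigenvalues])
       (auto simp: mult_nonneg_nonpos)
  \<comment> \<open>Testing the first-order condition in the direction \<open>x\<close> itself gives the drift term.\<close>
  moreover have "phase (r *\<^sub>R x) - phase x = k * (G1 (q x) * (x \<bullet> z) - phase (\<rho> *\<^sub>R x) + phase (r *\<^sub>R x))"
  proof -
    define p where "p = x \<bullet> gradient u (r *\<^sub>R x)"
    have xq: "x \<bullet> gradient u x = p / r - 2 * k * G1 (q x) * (x \<bullet> z)"
      using test[of 0] by (simp add: p_def)
    have ux: "u x = u (r *\<^sub>R x) / r\<^sup>2 - k * phase (\<rho> *\<^sub>R x)" using \<rho> by simp
    have ph: "phase (r *\<^sub>R x) = - u (r *\<^sub>R x) + r * p / 2" "phase x = - u x + (x \<bullet> gradient u x) / 2"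
      by (simp_all add: phase_eq p_def)
    have "k * (- u (r *\<^sub>R x) + r * p / 2) = - u (r *\<^sub>R x) + u (r *\<^sub>R x) / r\<^sup>2 + r * p / 2 - p / r / 2"
      using r by (simp add: k field_simps power2_eq_square)
    then show ?thesis
      unfolding ph xq ux by (simp add: algebra_simps diff_divide_distrib)
  qed
  ultimately have "k * (G1 (q x) * (x \<bullet> z) - phase (\<rho> *\<^sub>R x) + phase (r *\<^sub>R x))
      \<le> k * (2 * CARD('n) * G1 (q x) + 4 / 5 * G2 (q x) * (z \<bullet> z))"
    by (simp add: algebra_simps)
  then have "G1 (q x) * (x \<bullet> z) - phase (\<rho> *\<^sub>R x) + phase (r *\<^sub>R x)
      \<le> 2 * CARD('n) * G1 (q x) + 4 / 5 * G2 (q x) * (z \<bullet> z)"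
    using kpos by simp
  then show ?thesis by (simp add: qz z_def[symmetric] algebra_simps)
qed

end

section \<open>Maximum principle and Liouville theorem for the phase\<close>

text \<open>
  The barrier is \<open>\<kappa> q - exp (- \<alpha> q)\<close> as a function of \<open>q = (norm (x - y))\<^sup>2\<close>. Far away the drift
  \<open>x \<bullet> (x - y)\<close> dominates and every increasing concave function of \<open>q\<close> is a supersolution. In the
  remaining bounded shell, where \<open>q\<close> is bounded below by \<open>r\<^sup>2\<close>, a large \<open>\<alpha>\<close> makes the
  exponential concave enough; \<open>\<kappa>\<close> is then chosen so small that the linear term, needed for growth
  at infinity, does no harm there.
\<close>

lemma barrier_parameters:
  fixes y :: "'a::euclidean_space" and m r :: real
  assumes r: "0 < r" and m: "0 \<le> m"
  obtains \<kappa> \<alpha> where "0 < \<kappa>" "0 < \<alpha>"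
    "\<And>x. r \<le> norm (x - y) \<Longrightarrow>
      (\<kappa> + \<alpha> * exp (- \<alpha> * (norm (x - y))\<^sup>2)) * (x \<bullet> (x - y) - m)
        + 4 / 5 * (\<alpha>\<^sup>2 * exp (- \<alpha> * (norm (x - y))\<^sup>2)) * (norm (x - y))\<^sup>2 > 0"
proof -
  \<comment> \<open>Beyond squared distance \<open>R\<close> the drift outweighs \<open>m\<close>.\<close>
  define R where "R = (norm y)\<^sup>2 + 2 * m + 1"
  have R: "R > 0" using m by (simp add: R_def add_nonneg_pos)
  define \<alpha> where "\<alpha> = 5 / 4 * R / r\<^sup>2"
  have \<alpha>: "\<alpha> > 0" using R r by (simp add: \<alpha>_def)
  define \<kappa> where "\<kappa> = \<alpha> * exp (- \<alpha> * R)"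
  have \<kappa>: "\<kappa> > 0" using \<alpha> by (simp add: \<kappa>_def)
  show thesis
  proof (rule that[OF \<kappa> \<alpha>])
    fix x assume x: "r \<le> norm (x - y)"
    define q where "q = (norm (x - y))\<^sup>2"
    define E where "E = exp (- \<alpha> * q)"
    define b where "b = x \<bullet> (x - y) - m"
    have E: "E > 0" by (simp add: E_def)
    have q: "r\<^sup>2 \<le> q" using x r by (simp add: q_def power_mono)
    have "r\<^sup>2 > 0" using r by simp
    then have qpos: "q > 0" using q by linarith
    have "x \<bullet> (x - y) = q + y \<bullet> (x - y)"
      by (simp add: q_def power2_norm_eq_inner inner_diff_left)
    moreover have "0 \<le> q + 2 * (y \<bullet> (x - y)) + (norm y)\<^sup>2"
    proof -
      have "q + 2 * (y \<bullet> (x - y)) + (norm y)\<^sup>2 = x \<bullet> x"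
        by (simp add: q_def power2_norm_eq_inner inner_diff_left inner_diff_right inner_commute)
      then show ?thesis by simp
    qed
    ultimately have b: "2 * b \<ge> q - R + 1" unfolding b_def R_def by argo
    have "(\<kappa> + \<alpha> * E) * b + 4 / 5 * (\<alpha>\<^sup>2 * E) * q > 0"
    proof (cases "b > 0")
      case True
      then show ?thesis using \<kappa> \<alpha> E qpos by (simp add: add_pos_nonneg)
    next
      case False
      then have "q \<le> R" using b by linarith
      then have "\<kappa> \<le> \<alpha> * E" using \<alpha> by (simp add: \<kappa>_def E_def)
      then have "(\<kappa> + \<alpha> * E) * b \<ge> (2 * (\<alpha> * E)) * b"
        using False by (intro mult_right_mono_neg) (auto simp: mult.commute)
      moreover have "(\<alpha> * E) * (2 * b) \<ge> (\<alpha> * E) * (q - R + 1)"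
        using b \<alpha> E by (intro mult_left_mono) auto
      moreover have "(\<alpha> * E) * (q + 1) > 0" using \<alpha> E qpos by simp
      moreover have "4 / 5 * (\<alpha>\<^sup>2 * E) * q \<ge> (\<alpha> * E) * R"
      proof -
        have "R = 4 / 5 * \<alpha> * r\<^sup>2" using r by (simp add: \<alpha>_def)
        also have "\<dots> \<le> 4 / 5 * \<alpha> * q" using q \<alpha> by simp
        finally have "(\<alpha> * E) * R \<le> (\<alpha> * E) * (4 / 5 * \<alpha> * q)"
          using \<alpha> E by (intro mult_left_mono) auto
        then show ?thesis by (simp add: power2_eq_square mult_ac)
      qed
      ultimately show ?thesis by (simp add: algebra_simps)
    qed
    then show "(\<kappa> + \<alpha> * exp (- \<alpha> * (norm (x - y))\<^sup>2)) * (x \<bullet> (x - y) - m)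
        + 4 / 5 * (\<alpha>\<^sup>2 * exp (- \<alpha> * (norm (x - y))\<^sup>2)) * (norm (x - y))\<^sup>2 > 0"
      by (simp add: E_def b_def q_def)
  qed
qed

context hessian_bounded_self_shrinker
begin

text \<open>
  If \<open>phase - G\<close> exceeded its boundary values inside \<open>K\<close>, so would the dilation quotient minus \<open>G\<close> for \<open>r\<close> close
  to \<open>1\<close>, since the quotient converges to the phase uniformly on \<open>K\<close>. Its interior maximum then
  contradicts \<open>touching_estimate\<close>.
\<close>

lemma phase_comparison:
  fixes G G1 G2 :: "real \<Rightarrow> real" and y :: "real^'n"
  defines "q \<equiv> \<lambda>z. (z - y) \<bullet> (z - y)"
  assumes K: "compact K"
    and G: "\<And>t. (G has_real_derivative G1 t) (at t)" "\<And>t. (G1 has_real_derivative G2 t) (at t)"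
      "continuous_on UNIV G2"
    and sgn: "\<And>t. 0 \<le> G1 t" "\<And>t. G2 t \<le> 0"
    and super: "\<And>x. x \<in> K \<Longrightarrow> G1 (q x) * (x \<bullet> (x - y) - 2 * CARD('n)) - 4 / 5 * G2 (q x) * q x > 0"
    and bdry: "\<And>x. x \<in> K \<Longrightarrow> x \<notin> interior K \<Longrightarrow> phase x - G (q x) \<le> b"
    and x0: "x0 \<in> K"
  shows "phase x0 - G (q x0) \<le> b"
proof (rule ccontr)
  assume "\<not> phase x0 - G (q x0) \<le> b"
  then have gap: "phase x0 - G (q x0) - b > 0" by simp
  have "K \<noteq> {}" using x0 by blast
  have cG: "continuous_on UNIV G" "continuous_on UNIV G1"
    using G(1,2) by (meson DERIV_isCont continuous_at_imp_continuous_on)+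
  have cq: "continuous_on S q" for S
    unfolding q_def by (intro continuous_intros)
  have cGq: "continuous_on S (\<lambda>x. H (q x))" if "continuous_on UNIV H" for H :: "real \<Rightarrow> real" and S
    using continuous_on_compose2[OF that cq] by simp
  define D where "D x = G1 (q x) * (x \<bullet> (x - y) - 2 * CARD('n)) - 4 / 5 * G2 (q x) * q x" for x
  have "continuous_on K D"
    unfolding D_def by (intro continuous_intros cGq cG G(3) cq)
  from continuous_attains_inf[OF K \<open>K \<noteq> {}\<close> this]
  obtain xm where xm: "xm \<in> K" "\<And>x. x \<in> K \<Longrightarrow> D xm \<le> D x" by blast
  have D: "D xm > 0" using super[OF xm(1)] by (simp add: D_def)
  obtain C where C: "C > 0" "\<And>x. x \<in> K \<Longrightarrow> G1 (q x) \<le> C"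
  proof -
    obtain xc where "xc \<in> K" "\<And>x. x \<in> K \<Longrightarrow> G1 (q x) \<le> G1 (q xc)"
      using continuous_attains_sup[OF K \<open>K \<noteq> {}\<close> cGq[OF cG(2)]] by blast
    then show thesis using sgn(1)[of "q xc"] by (intro that[of "G1 (q xc) + 1"]) (auto intro: add_increasing2)
  qed
  obtain B where B: "B > 0" "\<And>x. x \<in> K \<Longrightarrow> norm x \<le> B"
    using compact_imp_bounded[OF K] by (meson bounded_pos)
  define \<gamma> where "\<gamma> = min (D xm) (phase x0 - G (q x0) - b) / 3"
  have \<gamma>: "\<gamma> > 0" "2 * \<gamma> < D xm" "2 * \<gamma> < phase x0 - G (q x0) - b"
    using D gap by (auto simp: \<gamma>_def min_def)
  have "uniformly_continuous_on (cball 0 (2 * B)) phase"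
    by (intro compact_uniformly_continuous continuous_on_phase compact_cball)
  then obtain \<tau> where \<tau>: "\<tau> > 0" "\<And>x x'. x \<in> cball 0 (2 * B) \<Longrightarrow> x' \<in> cball 0 (2 * B) \<Longrightarrow> dist x' x < \<tau>
      \<Longrightarrow> dist (phase x') (phase x) < \<gamma>"
    using \<gamma>(1) unfolding uniformly_continuous_on_def by metis
  \<comment> \<open>The bound by \<open>\<tau>\<close> makes the phases at \<open>\<rho> x\<close> and \<open>x\<close> close for \<open>\<rho> \<le> 1 + h\<close>; the bound by \<open>1 / (4 * C)\<close> keeps the shift \<open>2 * k * G1\<close> of the eigenvalues below \<open>1\<close>.\<close>
  define h where "h = Min {1, \<tau> / (2 * B), 1 / (4 * C)}"
  have h: "h > 0" "h \<le> 1" "h * B < \<tau>" "4 * h * C \<le> 1"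
  proof -
    show "h > 0" "h \<le> 1" using \<tau>(1) B(1) C(1) by (auto simp: h_def)
    have "h \<le> \<tau> / (2 * B)" "h \<le> 1 / (4 * C)" by (auto simp: h_def)
    then have "h * B \<le> \<tau> / 2" "4 * h * C \<le> 1" using B(1) C(1) by (auto simp: field_simps)
    then show "h * B < \<tau>" "4 * h * C \<le> 1" using \<tau>(1) by auto
  qed
  define r where "r = 1 + h"
  have r: "1 < r" using h(1) by (simp add: r_def)
  define k where "k = 1 - 1 / r\<^sup>2"
  have kpos: "k > 0" using r by (simp add: k_def)
  have kh: "k \<le> 2 * h"
  proof -
    have "(1 - 2 * h) * r\<^sup>2 = 1 - 3 * h\<^sup>2 - 2 * h ^ 3"
      by (simp add: r_def power2_eq_square power3_eq_cube algebra_simps)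
    also have "\<dots> \<le> 1"
      using zero_le_power[of h 2] zero_le_power[of h 3] h(1) by linarith
    finally have "1 - 2 * h \<le> 1 / r\<^sup>2" using r by (simp add: field_simps)
    then show ?thesis by (simp add: k_def)
  qed
  have near: "\<bar>phase (\<rho> *\<^sub>R x) - phase x\<bar> < \<gamma>" if "x \<in> K" "1 \<le> \<rho>" "\<rho> \<le> r" for x \<rho>
  proof -
    have nx: "norm x \<le> B" using B(2) that(1) by simp
    have "\<rho> * norm x \<le> 2 * B"
      using nx that h(2) B(1) by (intro mult_mono) (auto simp: r_def)
    then have "\<rho> *\<^sub>R x \<in> cball 0 (2 * B)" "x \<in> cball 0 (2 * B)" using that nx B(1) by auto
    moreover have "dist (\<rho> *\<^sub>R x) x < \<tau>"
    proof -
      have "\<rho> *\<^sub>R x - x = (\<rho> - 1) *\<^sub>R x" by (simp add: scaleR_diff_left)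
      then have "dist (\<rho> *\<^sub>R x) x = (\<rho> - 1) * norm x" using that by (simp add: dist_norm)
      also have "\<dots> \<le> h * B" using that nx h(1) by (intro mult_mono) (auto simp: r_def)
      finally show ?thesis using h(3) by linarith
    qed
    ultimately show ?thesis using \<tau>(2)[of x "\<rho> *\<^sub>R x"] by (simp add: dist_real_def)
  qed
  define W where "W x = u (r *\<^sub>R x) / r\<^sup>2 - u x" for x
  have W: "\<exists>\<rho>. 1 < \<rho> \<and> \<rho> < r \<and> W x = k * phase (\<rho> *\<^sub>R x)" for x
    using rescaling_difference[OF r, of x] unfolding W_def k_def by blast
  have "continuous_on K (\<lambda>x. u (r *\<^sub>R x))"
    by (rule continuous_on_compose2[OF continuous_on_u[of UNIV]]) (auto intro!: continuous_intros)
  then have "continuous_on K (\<lambda>x. W x - k * G (q x))"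
    unfolding W_def using r by (intro continuous_intros continuous_on_u cGq cG) auto
  from continuous_attains_sup[OF K \<open>K \<noteq> {}\<close> this]
  obtain x where x: "x \<in> K" "\<And>z. z \<in> K \<Longrightarrow> W z - k * G (q z) \<le> W x - k * G (q x)" by blast
  obtain \<rho> where \<rho>: "1 < \<rho>" "\<rho> < r" "W x = k * phase (\<rho> *\<^sub>R x)" using W by blast
  obtain \<rho>0 where \<rho>0: "1 < \<rho>0" "\<rho>0 < r" "W x0 = k * phase (\<rho>0 *\<^sub>R x0)" using W by blast
  have "k * (phase (\<rho>0 *\<^sub>R x0) - G (q x0)) \<le> k * (phase (\<rho> *\<^sub>R x) - G (q x))"
    using x(2)[OF x0] \<rho>(3) \<rho>0(3) by (simp add: algebra_simps)
  then have "phase (\<rho>0 *\<^sub>R x0) - G (q x0) \<le> phase (\<rho> *\<^sub>R x) - G (q x)" using kpos by simp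
  then have "phase x - G (q x) > b"
    using near[OF x(1), of \<rho>] near[OF x0, of \<rho>0] \<rho> \<rho>0 \<gamma>(3) by (simp add: abs_less_iff)
  then have "x \<in> interior K" using bdry[OF x(1)] by linarith
  then obtain e where e: "e > 0" "ball x e \<subseteq> K" by (auto simp: mem_interior)
  have "D x \<le> phase (\<rho> *\<^sub>R x) - phase (r *\<^sub>R x)"
    unfolding D_def q_def
  proof (rule touching_estimate[OF r k_def G(1,2) sgn _ e(1)])
    have "2 * k * G1 (q x) \<le> 2 * (2 * h) * C"
      using kh kpos C(2)[OF x(1)] sgn(1)[of "q x"] by (intro mult_mono) auto
    then show "2 * k * G1 ((x - y) \<bullet> (x - y)) \<le> 1" using h(4) by (simp add: q_def mult_ac)
    show "u (r *\<^sub>R x) / r\<^sup>2 - u x = k * phase (\<rho> *\<^sub>R x)" using \<rho>(3) by (simp add: W_def)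
    fix z assume "dist z x < e"
    then have "z \<in> K" using e(2) by (auto simp: dist_commute)
    from x(2)[OF this]
    show "u (r *\<^sub>R z) / r\<^sup>2 - u z - k * G ((z - y) \<bullet> (z - y)) \<le> u (r *\<^sub>R x) / r\<^sup>2 - u x - k * G ((x - y) \<bullet> (x - y))"
      by (simp add: W_def q_def)
  qed
  also have "\<dots> < 2 * \<gamma>"
    using near[OF x(1), of \<rho>] near[OF x(1), of r] \<rho> r by (simp add: abs_less_iff)
  finally show False using \<gamma>(2) xm(2)[OF x(1)] by linarith
qed

text \<open>
  Comparison on the shell between a small ball around \<open>y\<close>, where the phase is close to its value at \<open>y\<close>, and a
  sphere so large that a given multiple \<open>\<eta>\<close> of the barrier exceeds the oscillation of the bounded
  phase there. The multiple then tends to \<open>0\<close> with \<open>x0\<close> fixed.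
\<close>

lemma phase_le:
  "phase x0 \<le> phase y"
proof (rule field_le_epsilon)
  fix \<epsilon> :: real assume \<epsilon>: "0 < \<epsilon>"
  have "isCont phase y"
    using continuous_on_phase[of UNIV] by (simp add: continuous_on_eq_continuous_at)
  then obtain s where s: "s > 0" "\<And>x. dist x y < s \<Longrightarrow> dist (phase x) (phase y) < \<epsilon>"
    using \<epsilon> unfolding continuous_at_eps_delta by blast
  define r where "r = s / 2"
  have r: "r > 0" using s(1) by (simp add: r_def)
  have close: "phase x \<le> phase y + \<epsilon>" if "norm (x - y) \<le> r" for x
    using s(2)[of x] that s(1) by (simp add: r_def dist_norm dist_real_def abs_less_iff)
  show "phase x0 \<le> phase y + \<epsilon>"
  proof (cases "norm (x0 - y) \<le> r")
    case True
    then show ?thesis by (rule close)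
  next
    case False
    obtain \<kappa> \<alpha> where par: "0 < \<kappa>" "0 < \<alpha>"
      "\<And>x. r \<le> norm (x - y) \<Longrightarrow>
        (\<kappa> + \<alpha> * exp (- \<alpha> * (norm (x - y))\<^sup>2)) * (x \<bullet> (x - y) - 2 * CARD('n))
          + 4 / 5 * (\<alpha>\<^sup>2 * exp (- \<alpha> * (norm (x - y))\<^sup>2)) * (norm (x - y))\<^sup>2 > 0"
      using barrier_parameters[OF r, of "2 * CARD('n)" y] by auto
    define c where "c = 1 + \<kappa> * (norm (x0 - y))\<^sup>2"
    have c: "c > 0" using par by (simp add: c_def add_pos_nonneg)
    have bd: "phase x0 \<le> phase y + \<epsilon> + \<eta> * c" if \<eta>: "\<eta> > 0" for \<eta>
    proof -
      define G where "G t = \<eta> * (\<kappa> * t - exp (- \<alpha> * t))" for t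
      define G1 where "G1 t = \<eta> * (\<kappa> + \<alpha> * exp (- \<alpha> * t))" for t
      define G2 where "G2 t = - \<eta> * (\<alpha>\<^sup>2 * exp (- \<alpha> * t))" for t
      define R where "R = max (norm (x0 - y)) (max 1 (4 * CARD('n) / (\<eta> * \<kappa>)))"
      have R: "norm (x0 - y) \<le> R" "1 \<le> R" "4 * CARD('n) / (\<eta> * \<kappa>) \<le> R"
        by (auto simp: R_def)
      define K where "K = cball y R - ball y r"
      have inK: "x \<in> K \<longleftrightarrow> r \<le> norm (x - y) \<and> norm (x - y) \<le> R" for x
        by (auto simp: K_def dist_norm norm_minus_commute)
      have int: "x \<in> interior K" if "r < norm (x - y)" "norm (x - y) < R" for x
      proof (rule interiorI)
        show "open (ball y R - cball y r)" by (simp add: open_Diff)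
        show "x \<in> ball y R - cball y r" using that by (auto simp: dist_norm norm_minus_commute)
        show "ball y R - cball y r \<subseteq> K" by (auto simp: K_def)
      qed
      have "phase x0 - G ((x0 - y) \<bullet> (x0 - y)) \<le> phase y + \<epsilon> + \<eta>"
      proof (rule phase_comparison)
        show "compact K" unfolding K_def by (intro compact_diff) auto
        show "(G has_real_derivative G1 t) (at t)" for t
          unfolding G_def G1_def by (auto intro!: derivative_eq_intros)
        show "(G1 has_real_derivative G2 t) (at t)" for t
          unfolding G1_def G2_def by (auto intro!: derivative_eq_intros simp: power2_eq_square)
        show "continuous_on UNIV G2" unfolding G2_def by (intro continuous_intros)
        show "0 \<le> G1 t" "G2 t \<le> 0" for t
          using par \<eta> by (auto simp: G1_def G2_def)
        show "x0 \<in> K" using False R(1) by (simp add: inK)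
      next
        fix x assume "x \<in> K"
        then have "r \<le> norm (x - y)" by (simp add: inK)
        from mult_pos_pos[OF \<eta> par(3)[OF this]]
        show "0 < G1 ((x - y) \<bullet> (x - y)) * (x \<bullet> (x - y) - 2 * CARD('n))
            - 4 / 5 * G2 ((x - y) \<bullet> (x - y)) * ((x - y) \<bullet> (x - y))"
          unfolding G1_def G2_def power2_norm_eq_inner[symmetric] by (simp add: algebra_simps)
      next
        fix x assume x: "x \<in> K" "x \<notin> interior K"
        then consider "norm (x - y) \<le> r" | "norm (x - y) = R"
          using int[of x] by (force simp: inK)
        then show "phase x - G ((x - y) \<bullet> (x - y)) \<le> phase y + \<epsilon> + \<eta>"
        proof cases
          case 1
          have "- \<eta> \<le> G ((x - y) \<bullet> (x - y))"
          proof -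
            have "exp (- \<alpha> * ((x - y) \<bullet> (x - y))) \<le> 1" "0 \<le> \<kappa> * ((x - y) \<bullet> (x - y))" using par by auto
            then have "-1 \<le> \<kappa> * ((x - y) \<bullet> (x - y)) - exp (- \<alpha> * ((x - y) \<bullet> (x - y)))" by linarith
            from mult_left_mono[OF this, of \<eta>] \<eta> show ?thesis by (simp add: G_def)
          qed
          then show ?thesis using close[OF 1] by linarith
        next
          case 2
          then have q: "(x - y) \<bullet> (x - y) = R\<^sup>2" by (simp add: power2_norm_eq_inner[symmetric])
          have "R \<le> R\<^sup>2" using R(2) by (simp add: power2_eq_square)
          then have "4 * CARD('n) / (\<eta> * \<kappa>) \<le> R\<^sup>2" using R(3) by linarith
          then have "4 * CARD('n) \<le> \<eta> * \<kappa> * R\<^sup>2" using \<eta> par by (simp add: field_simps)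
          moreover have "\<eta> * exp (- \<alpha> * R\<^sup>2) \<le> \<eta>" using \<eta> par by (simp add: mult_le_cancel_left1)
          ultimately have "4 * CARD('n) - \<eta> \<le> G (R\<^sup>2)" by (simp add: G_def algebra_simps)
          then show ?thesis
            using abs_phase_le[of x] abs_phase_le[of y] \<epsilon> unfolding q by (simp add: abs_le_iff)
        qed
      qed
      moreover have "G ((x0 - y) \<bullet> (x0 - y)) \<le> \<eta> * (\<kappa> * (norm (x0 - y))\<^sup>2)"
        using \<eta> by (simp add: G_def power2_norm_eq_inner)
      ultimately show ?thesis by (simp add: c_def algebra_simps)
    qed
    show ?thesis
    proof (rule field_le_epsilon)
      fix d :: real assume "0 < d"
      then show "phase x0 \<le> phase y + \<epsilon> + d" using bd[of "d / c"] c by simp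
    qed
  qed
qed

lemma phase_constant: "phase x = phase 0"
  using phase_le by (intro antisym)

section \<open>Constant phase forces a quadratic polynomial\<close>

text \<open>
  Along each ray Euler's identity \<open>t * f' t = 2 * f t\<close> gives \<open>f t = t\<^sup>2 * f 1\<close>, and the second derivative at
  \<open>0\<close> identifies \<open>2 * f 1\<close> with the form of the Hessian at the origin.
\<close>

lemma u_eq_quadratic_form: "u x = x \<bullet> (hessian u 0 *v x) / 2 - phase 0"
proof -
  define c where "c = phase 0"
  define f where "f t = u (t *\<^sub>R x) + c" for t
  define f' where "f' t = x \<bullet> gradient u (t *\<^sub>R x)" for t
  have df: "(f has_real_derivative f' t) (at t)" for t
    using C2_line_derivatives(1)[OF C2, of 0 x t] unfolding f_def f'_def
    by (auto intro!: derivative_eq_intros)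
  have df': "(f' has_real_derivative x \<bullet> (hessian u 0 *v x)) (at 0)"
    using C2_line_derivatives(2)[OF C2, where x = 0 and v = x and t = 0] unfolding f'_def by simp
  have euler: "t * f' t = 2 * f t" for t
    using phase_eq[of "t *\<^sub>R x"] phase_constant[of "t *\<^sub>R x"] by (simp add: f_def f'_def c_def)
  have hom: "f t = t\<^sup>2 * f 1" if t: "t > 0" for t
  proof -
    have "((\<lambda>t. f t / t\<^sup>2) has_real_derivative 0) (at m)" if m: "m > 0" for m
    proof -
      have "((\<lambda>t. f t / t\<^sup>2) has_real_derivative (f' m * m\<^sup>2 - f m * (2 * m)) / (m\<^sup>2 * m\<^sup>2)) (at m)"
        using m df by (auto intro!: derivative_eq_intros)
      moreover have "f' m * m\<^sup>2 - f m * (2 * m) = m * (m * f' m - 2 * f m)"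
        by (simp add: algebra_simps power2_eq_square)
      ultimately show ?thesis by (simp add: euler)
    qed
    then have "f t / t\<^sup>2 = f 1 / 1\<^sup>2"
      using t by (intro DERIV_isconst3[of 0 "t + 2" t 1 "\<lambda>t. f t / t\<^sup>2"]) auto
    then show ?thesis using t by (simp add: field_simps)
  qed
  have f't: "f' t = 2 * f 1 * t" if "t > 0" for t
    using euler[of t] hom[OF that] that by (simp add: power2_eq_square)
  have "isCont f' 0" using df' by (rule DERIV_isCont)
  then have "(f' \<longlongrightarrow> f' 0) (at_right 0)"
    by (simp add: isCont_def filterlim_at_split)
  moreover have ev: "\<forall>\<^sub>F t in at_right (0::real). t > 0" by (simp add: eventually_at_right_less)
  then have "\<forall>\<^sub>F t in at_right 0. f' t = 2 * f 1 * t"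
    by eventually_elim (rule f't)
  ultimately have "((\<lambda>t. 2 * f 1 * t) \<longlongrightarrow> f' 0) (at_right 0)"
    by (rule Lim_transform_eventually)
  moreover have "((\<lambda>t. 2 * f 1 * t) \<longlongrightarrow> 2 * f 1 * 0) (at_right 0)"
    by (intro tendsto_intros)
  ultimately have f'0: "f' 0 = 0"
    using tendsto_unique[OF trivial_limit_at_right_real] by fastforce
  have "((\<lambda>t. (f' t - f' 0) / (t - 0)) \<longlongrightarrow> x \<bullet> (hessian u 0 *v x)) (at_right 0)"
    using df' unfolding has_field_derivative_iff by (simp add: filterlim_at_split)
  moreover have "\<forall>\<^sub>F t in at_right (0::real). (f' t - f' 0) / (t - 0) = 2 * f 1"
    using ev by eventually_elim (simp add: f't f'0)
  then have "((\<lambda>t. (f' t - f' 0) / (t - 0)) \<longlongrightarrow> 2 * f 1) (at_right 0)"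
    by (rule tendsto_eventually)
  ultimately have "x \<bullet> (hessian u 0 *v x) = 2 * f 1"
    by (rule tendsto_unique[OF trivial_limit_at_right_real])
  then show ?thesis by (simp add: f_def c_def field_simps)
qed

end

lemma quadratic_polynomial_quadratic_form:
  "quadratic_polynomial (\<lambda>x. x \<bullet> (A *v x) / 2 - c)"
  unfolding quadratic_polynomial_def
  by (rule exI[of _ "\<lambda>i j. A $ i $ j / 2"], rule exI[of _ "\<lambda>_. 0"], rule exI[of _ "- c"])
     (simp add: inner_vec_def matrix_vector_mult_def sum_distrib_left sum_divide_distrib mult_ac)

theorem theorem1p7:
  fixes u :: "real ^ 'n \<Rightarrow> real"
    and lam :: "real ^ 'n \<Rightarrow> 'n \<Rightarrow> real"
  assumes "C2 u"
    and "\<And>x. eigenvalue_family (hessian u x) (lam x)"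
    and "\<And>x. (\<Sum>i\<in>UNIV. arctan (lam x i)) = - u x + 1 / 2 * (\<Sum>i\<in>UNIV. x $ i * partial i u x)"
    and "\<And>x i. - 1 \<le> lam x i \<and> lam x i \<le> 1"
  shows "quadratic_polynomial u"
proof -
  interpret hessian_bounded_self_shrinker u lam
    using assms by unfold_locales
  have "u = (\<lambda>x. x \<bullet> (hessian u 0 *v x) / 2 - phase 0)"
    using u_eq_quadratic_form by blast
  then show ?thesis
    using quadratic_polynomial_quadratic_form by metis
qed

end
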